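(* Let $-\infty \le \delta_L < \delta_U \le \infty$, let $\theta_{j,r} \in \mathbb{R}$, let $\mathcal{I}(\theta_{j,r}) \in (0,\infty)$ be the Fisher information at $\theta_{j,r}$, and fix a point $u_{j,r} \in (0,1)$. For $\delta \in [-\infty,\infty]$ put $$a(\delta,\theta_{j,r}) = \frac{\delta-\theta_{j,r}}{\sqrt{\mathcal{I}(\theta_{j,r})^{-1}}},$$ and for real $n>0$ define $$p^{(n)}_{\delta,j,r} = \Phi\!\left(a(\delta,\theta_{j,r})\sqrt{n} - \Phi^{-1}(u_{j,r})\right).$$ Here $\Phi$ is the standard normal CDF, and the conventions $p^{(n)}_{+\infty,j,r}=1$, $p^{(n)}_{-\infty,j,r}=0$ and $a(\pm\infty,\theta_{j,r})^2=+\infty$ are used. Then $$\lim_{n\to\infty}\frac{d}{dn}\,\mathrm{logit}\!\left[p^{(n)}_{\delta_U,j,r}-p^{(n)}_{\delta_L,j,r}\right] = \Big(0.5-\mathbb{I}\{\theta_{j,r}\notin(\delta_L,\delta_U)\}\Big)\times \min\{a(\delta_U,\theta_{j,r})^2,\ a(\delta_L,\theta_{j,r})^2\},$$ where $\mathrm{logit}(x)=\log(x)-\log(1-x)$, $n$ is treated as a continuous variable, and $\mathbb{I}\{\cdot\}$ is the indicator function.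
   Context: Setting: $n$ i.i.d. observations are generated from a parametric model $f(\boldsymbol{w};\boldsymbol{\eta})$ with true parameter $\boldsymbol{\eta}_{j,r}$ drawn from a data-generating distribution $\Psi_j$ for $j\in\{0,1\}$. The scalar estimand is $\theta = g(\boldsymbol{\eta})$, with true value $\theta_{j,r}=g(\boldsymbol{\eta}_{j,r})$. The hypothesis of interest is $H_1:\theta\in(\delta_L,\delta_U)$. The paper assumes that the model satisfies the standard regularity conditions for asymptotic normality of the maximum likelihood estimator, and that the prior satisfies the conditions of the Bernstein–von Mises theorem. The only consequence used in the statement is that the Fisher information $\mathcal{I}(\theta_{j,r})$ is a finite positive number. Interpretation of the quantity $p^{(n)}_{\delta,j,r}$: it is a large-sample proxy for the posterior probability $Pr(\theta<\delta \mid \text{data})$. It is obtained by taking the posterior to be $\mathcal{N}(\hat\theta^{(n)},\mathcal{I}(\theta_{j,r})^{-1}/n)$, where the maximum likelihood estimate is generated by CDF inversion as $\hat\theta^{(n)}=\theta_{j,r}+\Phi^{-1}(u_{j,r})\sqrt{\mathcal{I}(\theta_{j,r})^{-1}/n}$. Consequently, $p^{(n)}_{\delta_U,j,r}-p^{(n)}_{\delta_L,j,r}$ serves as a proxy for $Pr(H_1\mid\text{data})$. *)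

theory Defs
  imports "HOL-Probability.Probability"
begin

definition Phi :: "real \<Rightarrow> real" where
  "Phi x = cdf std_normal_distribution x"

definition Phi_inv :: "real \<Rightarrow> real" where
  "Phi_inv u = (THE z. Phi z = u)"

definition a_std :: "real \<Rightarrow> real \<Rightarrow> real \<Rightarrow> real" where
  "a_std I theta d = (d - theta) / sqrt (inverse I)"

definition a_sq :: "real \<Rightarrow> real \<Rightarrow> ereal \<Rightarrow> ereal" where
  "a_sq I theta delta = (case delta of ereal d \<Rightarrow> ereal ((a_std I theta d)\<^sup>2) | _ \<Rightarrow> \<infinity>)"

definition p_post :: "real \<Rightarrow> real \<Rightarrow> real \<Rightarrow> ereal \<Rightarrow> real \<Rightarrow> real" where
  "p_post I theta u delta n =
     (case delta of ereal d \<Rightarrow> Phi (a_std I theta d * sqrt n - Phi_inv u)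
                  | PInfty \<Rightarrow> 1
                  | MInfty \<Rightarrow> 0)"

definition logit :: "real \<Rightarrow> real" where
  "logit x = ln x - ln (1 - x)"

end

theory Submission
  imports Defs "HOL-Real_Asymp.Real_Asymp"
begin

text \<open>
  Write P = Phi(x_U) - Phi(x_L) with x = a sqrt n - c, where a = a(delta, theta) and c = Phi^-1(u).
  The n-derivative of logit P is P' / (P (1 - P)), and P' is a difference of the terms
  phi(x) a / (2 sqrt n). For large n, P and 1 - P are built from Gaussian tails, and Mills' ratio
  Phi(-x) ~ phi(x) / x makes the hazard phi(x) a / (2 sqrt n) / Phi(-|x|) of each tail tend to
  +-a^2/2. If theta lies outside the interval, P -> 0 and the bound closer to theta, the one with
  the smaller a^2, dominates. If theta lies inside, P -> 1 and 1 - P is a sum of two tails; the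
  quotient of the two sums tends to the smaller a^2/2, either because the terms of the other
  bound are negligible or, when both a^2 agree, by the mediant inequality.
  The reflection a -> -a, c -> -c does not change the rate; it reduces everything to a_U <= 0 and
  to a_L < 0 < a_U with a_U^2 <= a_L^2.
\<close>

lemma lhopital_at_top_0:
  fixes f g :: "real \<Rightarrow> real"
  assumes f0: "(f \<longlongrightarrow> 0) at_top" and g0: "(g \<longlongrightarrow> 0) at_top"
    and gnz: "eventually (\<lambda>x. g x \<noteq> 0) at_top"
    and g': "eventually (\<lambda>x. g' x \<noteq> 0) at_top"
    and Df: "eventually (\<lambda>x. DERIV f x :> f' x) at_top"
    and Dg: "eventually (\<lambda>x. DERIV g x :> g' x) at_top"
    and lim: "((\<lambda> x. (f' x / g' x)) \<longlongrightarrow> y) at_top"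
  shows "((\<lambda> x. f x / g x) \<longlongrightarrow> y) at_top"
  unfolding filterlim_at_top_to_right
proof (rule lhopital_right_0)
  let ?F = "\<lambda>x. f (inverse x)"
  let ?G = "\<lambda>x. g (inverse x)"
  let ?R = "at_right (0::real)"
  let ?D = "\<lambda>f' x. f' (inverse x) * - (inverse x ^ Suc (Suc 0))"
  show "(?F \<longlongrightarrow> 0) ?R" using f0 unfolding filterlim_at_top_to_right .
  show "(?G \<longlongrightarrow> 0) ?R" using g0 unfolding filterlim_at_top_to_right .
  show "eventually (\<lambda>x. ?G x \<noteq> 0) ?R" using gnz by (simp add: eventually_at_right_to_top)
  show "eventually (\<lambda>x. DERIV ?G x :> ?D g' x) ?R"
    unfolding eventually_at_right_to_top
    using Dg eventually_ge_at_top[where c=1]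
    by eventually_elim (rule derivative_eq_intros DERIV_chain'[where f=inverse] | simp)+
  show "eventually (\<lambda>x. DERIV ?F x :> ?D f' x) ?R"
    unfolding eventually_at_right_to_top
    using Df eventually_ge_at_top[where c=1]
    by eventually_elim (rule derivative_eq_intros DERIV_chain'[where f=inverse] | simp)+
  show "eventually (\<lambda>x. ?D g' x \<noteq> 0) ?R"
    unfolding eventually_at_right_to_top
    using g' eventually_ge_at_top[where c=1]
    by eventually_elim auto
  show "((\<lambda>x. ?D f' x / ?D g' x) \<longlongrightarrow> y) ?R"
    unfolding filterlim_at_right_to_top
    apply (intro filterlim_cong[THEN iffD2, OF refl refl _ lim])
    using eventually_ge_at_top[where c=1]
    by eventually_elim simp
qed

lemma tendsto_sum_ratio_dominated:
  fixes A B X Y :: "'a \<Rightarrow> real"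
  assumes "((\<lambda>n. A n / X n) \<longlongrightarrow> L) F"
    and "((\<lambda>n. B n / A n) \<longlongrightarrow> 0) F" "((\<lambda>n. Y n / A n) \<longlongrightarrow> 0) F"
    and "\<forall>\<^sub>F n in F. A n \<noteq> 0 \<and> X n \<noteq> 0"
  shows "((\<lambda>n. (A n + B n) / (X n + Y n)) \<longlongrightarrow> L) F"
proof -
  have "((\<lambda>n. A n / X n * (1 + B n / A n) / (1 + Y n / A n * (A n / X n)))
      \<longlongrightarrow> L * (1 + 0) / (1 + 0 * L)) F"
    by (intro tendsto_intros assms) simp
  moreover have "\<forall>\<^sub>F n in F. A n / X n * (1 + B n / A n) / (1 + Y n / A n * (A n / X n))
      = (A n + B n) / (X n + Y n)"
    using assms(4)
  proof eventually_elim
    case (elim n)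
    then have "1 + B n / A n = (A n + B n) / A n" "1 + Y n / A n * (A n / X n) = (X n + Y n) / X n"
      by (simp_all add: field_simps)
    with elim show ?case by simp
  qed
  ultimately have "((\<lambda>n. (A n + B n) / (X n + Y n)) \<longlongrightarrow> L * (1 + 0) / (1 + 0 * L)) F"
    by (rule Lim_transform_eventually)
  then show ?thesis
    by simp
qed

lemma mediant_between:
  fixes A B X Y :: real
  assumes "0 < X" "0 < Y"
  shows "min (A / X) (B / Y) \<le> (A + B) / (X + Y)" "(A + B) / (X + Y) \<le> max (A / X) (B / Y)"
  using assms by (auto simp: min_def max_def field_simps)

lemma tendsto_mediant:
  fixes A B X Y :: "'a \<Rightarrow> real"
  assumes "((\<lambda>n. A n / X n) \<longlongrightarrow> L) F" "((\<lambda>n. B n / Y n) \<longlongrightarrow> L) F"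
    and "\<forall>\<^sub>F n in F. 0 < X n \<and> 0 < Y n"
  shows "((\<lambda>n. (A n + B n) / (X n + Y n)) \<longlongrightarrow> L) F"
proof (rule tendsto_sandwich)
  show "\<forall>\<^sub>F n in F. min (A n / X n) (B n / Y n) \<le> (A n + B n) / (X n + Y n)"
    "\<forall>\<^sub>F n in F. (A n + B n) / (X n + Y n) \<le> max (A n / X n) (B n / Y n)"
    using assms(3) by (auto elim: eventually_mono intro: mediant_between)
  show "((\<lambda>n. min (A n / X n) (B n / Y n)) \<longlongrightarrow> L) F"
    "((\<lambda>n. max (A n / X n) (B n / Y n)) \<longlongrightarrow> L) F"
    using tendsto_min[OF assms(1,2)] tendsto_max[OF assms(1,2)] by simp_all
qed

lemma ereal_power2_less_of_less_neg:
  assumes "a < ereal r" "r < 0"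
  shows "ereal (r\<^sup>2) < a\<^sup>2"
proof (cases a)
  case (real l)
  then have "(- r)\<^sup>2 < (- l)\<^sup>2"
    using assms by (intro power_strict_mono) auto
  with real show ?thesis by simp
qed (use assms in \<open>simp_all add: power2_eq_square\<close>)

lemma has_real_derivative_logit:
  assumes "(P has_real_derivative P') (at n)" "0 < P n" "P n < 1"
  shows "((\<lambda>n. logit (P n)) has_real_derivative P' / (P n * (1 - P n))) (at n)"
proof -
  have "((\<lambda>n. ln (P n) - ln (1 - P n)) has_real_derivative P' / P n - - P' / (1 - P n)) (at n)"
    using assms by (auto intro!: derivative_eq_intros)
  moreover have "P' / P n - - P' / (1 - P n) = P' / (P n * (1 - P n))"
    using assms(2,3) by (simp add: field_simps)
  ultimately show ?thesis
    by (simp add: logit_def)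
qed

section \<open>The standard normal distribution\<close>

lemma continuous_on_std_normal_density: "continuous_on S std_normal_density"
  unfolding std_normal_density_def by (intro continuous_intros) simp

lemma Phi_diff_eq_integral:
  assumes "a < x"
  shows "Phi x - Phi a = integral {a..x} std_normal_density"
proof -
  let ?M = std_normal_distribution
  interpret real_distribution ?M by (rule real_dist_normal_dist)
  have int: "(std_normal_density has_integral integral {a..x} std_normal_density) {a<..x}"
    using integrable_continuous_real[OF continuous_on_std_normal_density]
    by (subst has_integral_spike_set_eq[where T="{a..x}"])
       (auto intro: negligible_subset[OF negligible_sing[of a]])
  have "emeasure ?M {a<..x} = (\<integral>\<^sup>+ y. ennreal (std_normal_density y) * indicator {a<..x} y \<partial>lborel)"
    by (subst emeasure_density) auto
  also have "\<dots> = ennreal (integral {a..x} std_normal_density)"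
    by (rule nn_integral_has_integral_lebesgue'[OF _ int]) simp
  finally have "measure ?M {a<..x} = integral {a..x} std_normal_density"
    using integral_nonneg[OF integrable_continuous_real[OF continuous_on_std_normal_density]]
    by (simp add: measure_def)
  then show ?thesis
    unfolding Phi_def using cdf_diff_eq[OF assms] by simp
qed

lemma has_real_derivative_Phi: "(Phi has_real_derivative std_normal_density x) (at x)"
proof -
  have "((\<lambda>t. integral {x - 1..t} std_normal_density) has_real_derivative std_normal_density x)
      (at x within {x - 1..x + 1})"
    by (rule integral_has_real_derivative[OF continuous_on_std_normal_density]) auto
  then have "((\<lambda>t. Phi (x - 1) + integral {x - 1..t} std_normal_density)
      has_real_derivative std_normal_density x) (at x)"
    by (subst (asm) at_within_interior) (auto intro!: derivative_eq_intros)
  then show ?thesis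
    by (rule has_field_derivative_transform_within_open[where S="{x - 1<..<x + 1}"])
       (auto simp: Phi_diff_eq_integral[symmetric])
qed

lemma Phi_at_top: "(Phi \<longlongrightarrow> 1) at_top"
proof -
  interpret real_distribution std_normal_distribution by (rule real_dist_normal_dist)
  show ?thesis unfolding Phi_def[abs_def] by (rule cdf_lim_at_top_prob)
qed

lemma Phi_at_bot: "(Phi \<longlongrightarrow> 0) at_bot"
proof -
  interpret real_distribution std_normal_distribution by (rule real_dist_normal_dist)
  show ?thesis unfolding Phi_def[abs_def] by (rule cdf_lim_at_bot)
qed

lemma Phi_strict_mono: "x < y \<Longrightarrow> Phi x < Phi y"
  by (rule DERIV_pos_imp_increasing[of x y Phi])
     (auto intro!: has_real_derivative_Phi normal_density_pos)

lemma Phi_bounds: "0 < Phi x" "Phi x < 1"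
proof -
  interpret real_distribution std_normal_distribution by (rule real_dist_normal_dist)
  show "0 < Phi x"
    using Phi_strict_mono[of "x - 1" x] cdf_nonneg[of "x - 1"] by (simp add: Phi_def)
  show "Phi x < 1"
    using Phi_strict_mono[of x "x + 1"] cdf_bounded_prob[of "x + 1"] by (simp add: Phi_def)
qed

lemma std_normal_density_pos: "0 < std_normal_density x"
  by (simp add: normal_density_pos)

lemma std_normal_density_minus: "std_normal_density (- x) = std_normal_density x"
  by (simp add: std_normal_density_def)

lemma has_real_derivative_Phi_minus:
  "((\<lambda>x. Phi (- x)) has_real_derivative - std_normal_density x) (at x)"
  using DERIV_chain2[OF has_real_derivative_Phi DERIV_minus[OF DERIV_ident]]
  by (simp add: std_normal_density_minus)

lemma Phi_minus: "Phi (- x) = 1 - Phi x"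
proof -
  have "DERIV (\<lambda>x. Phi (- x) + Phi x) x :> 0" for x
    using DERIV_add[OF has_real_derivative_Phi_minus has_real_derivative_Phi] by simp
  then obtain k where k: "\<And>x. Phi (- x) + Phi x = k"
    using DERIV_isconst_all by metis
  have "((\<lambda>x. Phi (- x) + Phi x) \<longlongrightarrow> 0 + 1) at_top"
    by (intro tendsto_add Phi_at_top filterlim_compose[OF Phi_at_bot] filterlim_uminus_at_bot_at_top)
  then have "k = 1"
    by (simp add: k tendsto_const_iff)
  then show ?thesis using k[of x] by simp
qed

lemma has_real_derivative_std_normal_density:
  "(std_normal_density has_real_derivative - x * std_normal_density x) (at x)"
proof -
  have "((\<lambda>x. exp (- x\<^sup>2 / 2)) has_real_derivative - x * exp (- x\<^sup>2 / 2)) (at x)"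
    by (auto intro!: derivative_eq_intros)
  then show ?thesis
    unfolding std_normal_density_def[abs_def] by (auto dest: DERIV_cmult[where c="1 / sqrt (2 * pi)"])
qed

lemma mills_ratio: "((\<lambda>x. std_normal_density x / (x * Phi (- x))) \<longlongrightarrow> 1) at_top"
proof -
  let ?\<phi> = std_normal_density
  have "((\<lambda>x. ?\<phi> x / x / Phi (- x)) \<longlongrightarrow> 1) at_top"
  proof (rule lhopital_at_top_0)
    show "((\<lambda>x. ?\<phi> x / x) \<longlongrightarrow> 0) at_top"
      unfolding std_normal_density_def by real_asymp
    show "((\<lambda>x. Phi (- x)) \<longlongrightarrow> 0) at_top"
      by (rule filterlim_compose[OF Phi_at_bot filterlim_uminus_at_bot_at_top])
    show "\<forall>\<^sub>F x in at_top. Phi (- x) \<noteq> 0" "\<forall>\<^sub>F x in at_top. - ?\<phi> x \<noteq> 0"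
      using Phi_bounds(1) std_normal_density_pos by (auto simp: less_le)
    show "\<forall>\<^sub>F x in at_top. ((\<lambda>x. ?\<phi> x / x) has_real_derivative - ?\<phi> x - ?\<phi> x / x\<^sup>2) (at x)"
      using eventually_gt_at_top[of 0]
      by eventually_elim
        (auto intro!: derivative_eq_intros has_real_derivative_std_normal_density
          simp: field_simps power2_eq_square)
    show "\<forall>\<^sub>F x in at_top. ((\<lambda>x. Phi (- x)) has_real_derivative - ?\<phi> x) (at x)"
      by (simp add: has_real_derivative_Phi_minus)
    have "(- ?\<phi> x - ?\<phi> x / x\<^sup>2) / - ?\<phi> x = 1 + 1 / x\<^sup>2" for x
      using std_normal_density_pos[of x] by (simp add: field_simps)
    moreover have "((\<lambda>x::real. 1 + 1 / x\<^sup>2) \<longlongrightarrow> 1) at_top" by real_asymp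
    ultimately show "((\<lambda>x. (- ?\<phi> x - ?\<phi> x / x\<^sup>2) / - ?\<phi> x) \<longlongrightarrow> 1) at_top"
      by simp
  qed
  then show ?thesis by simp
qed

lemma std_normal_density_ratio_tendsto_0:
  assumes "r\<^sup>2 < l\<^sup>2"
  shows "((\<lambda>n. std_normal_density (l * sqrt n - c) / std_normal_density (r * sqrt n - c))
    \<longlongrightarrow> 0) at_top"
proof -
  define d where "d = (l\<^sup>2 - r\<^sup>2) / 2"
  have "d > 0" using assms by (simp add: d_def)
  then have lim: "((\<lambda>n. exp (- d * n + c * (l - r) * sqrt n)) \<longlongrightarrow> 0) at_top"
    by real_asymp
  have eq: "exp (- d * n + c * (l - r) * sqrt n)
      = std_normal_density (l * sqrt n - c) / std_normal_density (r * sqrt n - c)" if "0 < n" for n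
  proof -
    have "- d * n + c * (l - r) * sqrt n = - (l * sqrt n - c)\<^sup>2 / 2 - - (r * sqrt n - c)\<^sup>2 / 2"
      using that by (simp add: d_def power2_eq_square field_simps)
    then have "exp (- d * n + c * (l - r) * sqrt n)
        = exp (- (l * sqrt n - c)\<^sup>2 / 2) / exp (- (r * sqrt n - c)\<^sup>2 / 2)"
      by (simp only: exp_diff)
    then show ?thesis
      by (simp add: std_normal_density_def)
  qed
  have "\<forall>\<^sub>F n in at_top. exp (- d * n + c * (l - r) * sqrt n)
      = std_normal_density (l * sqrt n - c) / std_normal_density (r * sqrt n - c)"
    using eventually_gt_at_top[of 0] by eventually_elim (rule eq)
  with lim show ?thesis
    by (rule Lim_transform_eventually)
qed

section \<open>Posterior probabilities along the sample size\<close>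

definition Phi_path :: "real \<Rightarrow> ereal \<Rightarrow> real \<Rightarrow> real" where
  "Phi_path c a n = (case a of ereal r \<Rightarrow> Phi (r * sqrt n - c) | PInfty \<Rightarrow> 1 | MInfty \<Rightarrow> 0)"

definition Phi_path_deriv :: "real \<Rightarrow> ereal \<Rightarrow> real \<Rightarrow> real" where
  "Phi_path_deriv c a n =
     (case a of ereal r \<Rightarrow> std_normal_density (r * sqrt n - c) * r / (2 * sqrt n) | _ \<Rightarrow> 0)"

lemma Phi_path_simps [simp]:
  "Phi_path c (ereal r) n = Phi (r * sqrt n - c)" "Phi_path c \<infinity> n = 1" "Phi_path c (-\<infinity>) n = 0"
  by (simp_all add: Phi_path_def)

lemma Phi_path_deriv_simps [simp]:
  "Phi_path_deriv c (ereal r) n = std_normal_density (r * sqrt n - c) * r / (2 * sqrt n)"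
  "Phi_path_deriv c \<infinity> n = 0" "Phi_path_deriv c (-\<infinity>) n = 0"
  by (simp_all add: Phi_path_deriv_def)

lemma Phi_path_reflect: "Phi_path (- c) (- a) n = 1 - Phi_path c a n"
  by (cases a) (simp_all add: Phi_minus[symmetric])

lemma Phi_path_deriv_reflect: "Phi_path_deriv (- c) (- a) n = - Phi_path_deriv c a n"
proof (cases a)
  case (real r)
  have "- r * sqrt n - - c = - (r * sqrt n - c)" by simp
  then show ?thesis
    using real by (simp only: uminus_ereal.simps Phi_path_deriv_simps std_normal_density_minus)
qed simp_all

lemma has_real_derivative_Phi_path:
  assumes "0 < n"
  shows "((Phi_path c a) has_real_derivative Phi_path_deriv c a n) (at n)"
proof (cases a)
  case (real r)
  have "((\<lambda>n. r * sqrt n - c) has_real_derivative r / (2 * sqrt n)) (at n)"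
    using assms by (auto intro!: derivative_eq_intros simp: field_simps)
  from DERIV_chain2[OF has_real_derivative_Phi this] show ?thesis
    using real by (simp add: Phi_path_def[abs_def])
qed (simp_all add: Phi_path_def[abs_def])

lemma Phi_path_strict_mono:
  assumes "a < b" "0 < n"
  shows "Phi_path c a n < Phi_path c b n"
  using assms Phi_bounds by (cases a; cases b) (auto intro: Phi_strict_mono)

lemma Phi_path_diff_bounds:
  assumes "aL < aU" "\<bar>aL\<bar> \<noteq> \<infinity> \<or> \<bar>aU\<bar> \<noteq> \<infinity>" "0 < n"
  shows "0 < Phi_path c aU n - Phi_path c aL n" "Phi_path c aU n - Phi_path c aL n < 1"
proof -
  show "0 < Phi_path c aU n - Phi_path c aL n"
    using Phi_path_strict_mono[OF assms(1,3)] by simp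
  show "Phi_path c aU n - Phi_path c aL n < 1"
    using assms Phi_bounds[of "real_of_ereal aL * sqrt n - c"] Phi_bounds[of "real_of_ereal aU * sqrt n - c"]
    by (cases aL; cases aU) auto
qed

lemma Phi_path_tendsto_0:
  assumes "a < 0"
  shows "(Phi_path c a \<longlongrightarrow> 0) at_top"
proof (cases a)
  case (real r)
  have "filterlim (\<lambda>n. r * sqrt n - c) at_bot at_top"
    using assms real by real_asymp
  moreover have "Phi_path c a = (\<lambda>n. Phi (r * sqrt n - c))"
    using real by (simp add: fun_eq_iff)
  ultimately show ?thesis by (simp add: filterlim_compose[OF Phi_at_bot])
qed (use assms in \<open>simp_all add: Phi_path_def[abs_def]\<close>)

lemma Phi_path_tendsto_1:
  assumes "0 < a"
  shows "(Phi_path c a \<longlongrightarrow> 1) at_top"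
proof -
  have "((\<lambda>n. 1 - Phi_path (- c) (- a) n) \<longlongrightarrow> 1 - 0) at_top"
    using assms by (intro tendsto_diff tendsto_const Phi_path_tendsto_0) (simp add: ereal_uminus_less_reorder)
  then show ?thesis by (simp add: Phi_path_reflect)
qed

lemma Phi_path_hazard_neg:
  assumes "r < 0"
  shows "((\<lambda>n. Phi_path_deriv c (ereal r) n / Phi_path c (ereal r) n) \<longlongrightarrow> - (r\<^sup>2 / 2)) at_top"
proof -
  define x where "x n = c - r * sqrt n" for n
  have x: "filterlim x at_top at_top"
    using assms unfolding x_def by real_asymp
  have "((\<lambda>n. x n * r / (2 * sqrt n)) \<longlongrightarrow> - (r\<^sup>2 / 2)) at_top"
    using assms unfolding x_def power2_eq_square by real_asymp
  then have "((\<lambda>n. std_normal_density (x n) / (x n * Phi (- x n)) * (x n * r / (2 * sqrt n)))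
      \<longlongrightarrow> 1 * - (r\<^sup>2 / 2)) at_top"
    by (intro tendsto_mult filterlim_compose[OF mills_ratio x])
  moreover have "\<forall>\<^sub>F n in at_top.
      std_normal_density (x n) / (x n * Phi (- x n)) * (x n * r / (2 * sqrt n))
      = Phi_path_deriv c (ereal r) n / Phi_path c (ereal r) n"
    using x[unfolded filterlim_at_top_dense, THEN spec, of 0] eventually_gt_at_top[of 0]
    by eventually_elim (auto simp: x_def std_normal_density_minus[of "r * _ - c", symmetric])
  ultimately show ?thesis
    by (simp add: tendsto_cong)
qed

lemma Phi_path_hazard_pos:
  assumes "0 < r"
  shows "((\<lambda>n. Phi_path_deriv c (ereal r) n / (1 - Phi_path c (ereal r) n)) \<longlongrightarrow> r\<^sup>2 / 2) at_top"
proof -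
  have "((\<lambda>n. - (Phi_path_deriv (- c) (ereal (- r)) n / Phi_path (- c) (ereal (- r)) n))
      \<longlongrightarrow> - (- ((- r)\<^sup>2 / 2))) at_top"
    using assms by (intro tendsto_minus Phi_path_hazard_neg) simp
  moreover have "std_normal_density (c - r * sqrt n) = std_normal_density (r * sqrt n - c)" for n
    by (metis minus_diff_eq std_normal_density_minus)
  ultimately show ?thesis
    using Phi_path_reflect[of c "ereal r"] Phi_path_deriv_reflect[of c "ereal r"] by simp
qed

lemma Phi_path_deriv_ratio_tendsto_0:
  assumes "ereal (r\<^sup>2) < a\<^sup>2" "r \<noteq> 0"
  shows "((\<lambda>n. Phi_path_deriv c a n / Phi_path_deriv c (ereal r) n) \<longlongrightarrow> 0) at_top"
proof (cases a)
  case (real l)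
  have "((\<lambda>n. std_normal_density (l * sqrt n - c) / std_normal_density (r * sqrt n - c) * (l / r))
      \<longlongrightarrow> 0 * (l / r)) at_top"
    using assms real by (intro tendsto_mult std_normal_density_ratio_tendsto_0) simp_all
  moreover have "\<forall>\<^sub>F n in at_top.
      std_normal_density (l * sqrt n - c) / std_normal_density (r * sqrt n - c) * (l / r)
      = Phi_path_deriv c a n / Phi_path_deriv c (ereal r) n"
    using eventually_gt_at_top[of 0]
    by eventually_elim (use assms(2) real in simp)
  ultimately have "((\<lambda>n. Phi_path_deriv c a n / Phi_path_deriv c (ereal r) n) \<longlongrightarrow> 0 * (l / r)) at_top"
    by (rule Lim_transform_eventually)
  then show ?thesis
    by simp
qed simp_all

lemma Phi_path_ratio_tendsto_0:
  assumes "a < 0" "ereal (r\<^sup>2) < a\<^sup>2" "r \<noteq> 0"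
  shows "((\<lambda>n. Phi_path c a n / Phi_path_deriv c (ereal r) n) \<longlongrightarrow> 0) at_top"
proof (cases a)
  case (real l)
  then have "l < 0" using assms by simp
  have "((\<lambda>n. inverse (Phi_path_deriv c a n / Phi_path c a n)
      * (Phi_path_deriv c a n / Phi_path_deriv c (ereal r) n)) \<longlongrightarrow> inverse (- (l\<^sup>2 / 2)) * 0) at_top"
    unfolding real using \<open>l < 0\<close> assms real
    by (intro tendsto_mult tendsto_inverse Phi_path_hazard_neg Phi_path_deriv_ratio_tendsto_0) simp_all
  moreover have "\<forall>\<^sub>F n in at_top. inverse (Phi_path_deriv c a n / Phi_path c a n)
      * (Phi_path_deriv c a n / Phi_path_deriv c (ereal r) n) = Phi_path c a n / Phi_path_deriv c (ereal r) n"
    using eventually_gt_at_top[of 0]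
    by eventually_elim (use \<open>l < 0\<close> real std_normal_density_pos[THEN order_less_imp_not_eq2]
        Phi_bounds(1)[THEN order_less_imp_not_eq2] in simp)
  ultimately have "((\<lambda>n. Phi_path c a n / Phi_path_deriv c (ereal r) n)
      \<longlongrightarrow> inverse (- (l\<^sup>2 / 2)) * 0) at_top"
    by (rule Lim_transform_eventually)
  then show ?thesis
    by simp
qed (use assms in simp_all)

section \<open>The logit rate and its limit\<close>

definition logit_rate :: "real \<Rightarrow> ereal \<Rightarrow> ereal \<Rightarrow> real \<Rightarrow> real" where
  "logit_rate c aL aU n =
     (Phi_path_deriv c aU n - Phi_path_deriv c aL n)
     / ((Phi_path c aU n - Phi_path c aL n) * (1 - (Phi_path c aU n - Phi_path c aL n)))"

lemma logit_rate_reflect: "logit_rate (- c) (- aU) (- aL) = logit_rate c aL aU"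
  unfolding logit_rate_def Phi_path_reflect Phi_path_deriv_reflect by (simp add: fun_eq_iff algebra_simps)

lemma has_real_derivative_logit_Phi_path_diff:
  assumes "aL < aU" "\<bar>aL\<bar> \<noteq> \<infinity> \<or> \<bar>aU\<bar> \<noteq> \<infinity>" "0 < n"
  shows "((\<lambda>n. logit (Phi_path c aU n - Phi_path c aL n)) has_real_derivative logit_rate c aL aU n) (at n)"
  unfolding logit_rate_def
  using Phi_path_diff_bounds[OF assms]
  by (intro has_real_derivative_logit DERIV_diff has_real_derivative_Phi_path assms(3))

lemma logit_rate_tendsto_below:
  assumes "aL < ereal r" "r < 0"
  shows "(logit_rate c aL (ereal r) \<longlongrightarrow> - (r\<^sup>2 / 2)) at_top"
proof -
  have sq: "ereal (r\<^sup>2) < aL\<^sup>2"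
    using assms by (rule ereal_power2_less_of_less_neg)
  have "aL < 0"
    using assms by (simp add: order.strict_trans zero_ereal_def)
  let ?A = "Phi_path_deriv c (ereal r)" and ?B = "\<lambda>n. - Phi_path_deriv c aL n"
  let ?X = "Phi_path c (ereal r)" and ?Y = "\<lambda>n. - Phi_path c aL n"
  have ratio: "((\<lambda>n. (?A n + ?B n) / (?X n + ?Y n)) \<longlongrightarrow> - (r\<^sup>2 / 2)) at_top"
  proof (rule tendsto_sum_ratio_dominated)
    show "((\<lambda>n. ?A n / ?X n) \<longlongrightarrow> - (r\<^sup>2 / 2)) at_top"
      using assms(2) by (rule Phi_path_hazard_neg)
    show "((\<lambda>n. ?B n / ?A n) \<longlongrightarrow> 0) at_top" "((\<lambda>n. ?Y n / ?A n) \<longlongrightarrow> 0) at_top"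
      using tendsto_minus[OF Phi_path_deriv_ratio_tendsto_0[OF sq]]
        tendsto_minus[OF Phi_path_ratio_tendsto_0[OF \<open>aL < 0\<close> sq]] assms(2)
      by simp_all
    show "\<forall>\<^sub>F n in at_top. ?A n \<noteq> 0 \<and> ?X n \<noteq> 0"
      using eventually_gt_at_top[of 0]
      by eventually_elim (use assms(2) std_normal_density_pos[THEN order_less_imp_not_eq2]
          Phi_bounds(1)[THEN order_less_imp_not_eq2] in simp)
  qed
  have "((\<lambda>n. ?X n - Phi_path c aL n) \<longlongrightarrow> 0 - 0) at_top"
    using assms(2) \<open>aL < 0\<close> by (intro tendsto_diff Phi_path_tendsto_0) simp_all
  from tendsto_divide[OF ratio tendsto_diff[OF tendsto_const this, of 1]]
  show ?thesis
    by (simp add: logit_rate_def[abs_def])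
qed

lemma logit_rate_tendsto_zero:
  assumes "aL < 0"
  shows "(logit_rate c aL 0 \<longlongrightarrow> 0) at_top"
proof -
  have "(Phi_path_deriv c aL \<longlongrightarrow> 0) at_top"
  proof (cases aL)
    case (real l)
    then have "l < 0" using assms by simp
    then have "((\<lambda>n. std_normal_density (l * sqrt n - c) * l / (2 * sqrt n)) \<longlongrightarrow> 0) at_top"
      unfolding std_normal_density_def by real_asymp
    with real show ?thesis by (simp add: Phi_path_deriv_def[abs_def])
  qed (use assms in \<open>simp_all add: Phi_path_deriv_def[abs_def]\<close>)
  then have "((\<lambda>n. (0 - Phi_path_deriv c aL n)
      / ((Phi (- c) - Phi_path c aL n) * (1 - (Phi (- c) - Phi_path c aL n))))
      \<longlongrightarrow> (0 - 0) / ((Phi (- c) - 0) * (1 - (Phi (- c) - 0)))) at_top"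
    by (intro tendsto_intros Phi_path_tendsto_0 assms) (use Phi_bounds[of "- c"] in auto)
  then show ?thesis
    by (simp add: logit_rate_def[abs_def] zero_ereal_def)
qed

lemma logit_rate_tendsto_straddle:
  assumes "aL < 0" "0 < r" "ereal (r\<^sup>2) \<le> aL\<^sup>2"
  shows "(logit_rate c aL (ereal r) \<longlongrightarrow> r\<^sup>2 / 2) at_top"
proof -
  let ?A = "Phi_path_deriv c (ereal r)" and ?B = "\<lambda>n. - Phi_path_deriv c aL n"
  let ?X = "\<lambda>n. 1 - Phi_path c (ereal r) n" and ?Y = "Phi_path c aL"
  have hazard: "((\<lambda>n. ?A n / ?X n) \<longlongrightarrow> r\<^sup>2 / 2) at_top"
    using assms(2) by (rule Phi_path_hazard_pos)
  have ratio: "((\<lambda>n. (?A n + ?B n) / (?X n + ?Y n)) \<longlongrightarrow> r\<^sup>2 / 2) at_top"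
  proof (cases "ereal (r\<^sup>2) < aL\<^sup>2")
    case True
    show ?thesis
    proof (rule tendsto_sum_ratio_dominated[OF hazard])
      show "((\<lambda>n. ?B n / ?A n) \<longlongrightarrow> 0) at_top" "((\<lambda>n. ?Y n / ?A n) \<longlongrightarrow> 0) at_top"
        using tendsto_minus[OF Phi_path_deriv_ratio_tendsto_0[OF True]]
          Phi_path_ratio_tendsto_0[OF assms(1) True] assms(2)
        by simp_all
      show "\<forall>\<^sub>F n in at_top. ?A n \<noteq> 0 \<and> ?X n \<noteq> 0"
        using eventually_gt_at_top[of 0]
        by eventually_elim (use assms(2) std_normal_density_pos[THEN order_less_imp_not_eq2]
            Phi_bounds(2)[THEN order_less_imp_not_eq2] in simp)
    qed
  next
    case False
    \<comment> \<open>neither tail dominates, but both hazards tend to \<open>r\<^sup>2 / 2\<close>\<close>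
    then obtain l where l: "aL = ereal l" "l < 0" "l\<^sup>2 = r\<^sup>2"
      using assms by (cases aL) (auto simp: power2_eq_square)
    show ?thesis
    proof (rule tendsto_mediant[OF hazard])
      show "((\<lambda>n. ?B n / ?Y n) \<longlongrightarrow> r\<^sup>2 / 2) at_top"
        using tendsto_minus[OF Phi_path_hazard_neg[OF l(2)]] l by simp
      show "\<forall>\<^sub>F n in at_top. 0 < ?X n \<and> 0 < ?Y n"
        using l Phi_bounds by simp
    qed
  qed
  have "((\<lambda>n. Phi_path c (ereal r) n - ?Y n) \<longlongrightarrow> 1 - 0) at_top"
    using assms by (intro tendsto_diff Phi_path_tendsto_0 Phi_path_tendsto_1) simp_all
  from tendsto_divide[OF ratio this]
  show ?thesis
    by (simp add: logit_rate_def[abs_def] algebra_simps)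
qed

definition logit_rate_limit :: "ereal \<Rightarrow> ereal \<Rightarrow> real" where
  "logit_rate_limit aL aU =
     (if aL < 0 \<and> 0 < aU then 1 / 2 else - 1 / 2) * real_of_ereal (min (aL\<^sup>2) (aU\<^sup>2))"

lemma logit_rate_limit_reflect: "logit_rate_limit (- aU) (- aL) = logit_rate_limit aL aU"
  unfolding logit_rate_limit_def
  by (simp add: min.commute ereal_uminus_less_reorder ereal_less_uminus_reorder)

lemma ereal_logit_rate_limit:
  assumes "\<bar>aL\<bar> \<noteq> \<infinity> \<or> \<bar>aU\<bar> \<noteq> \<infinity>"
  shows "ereal (logit_rate_limit aL aU)
    = ereal (if aL < 0 \<and> 0 < aU then 1 / 2 else - 1 / 2) * min (aL\<^sup>2) (aU\<^sup>2)"
proof -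
  have "\<bar>min (aL\<^sup>2) (aU\<^sup>2)\<bar> \<noteq> \<infinity>"
    using assms by (cases aL; cases aU) (auto simp: min_def power2_eq_square)
  then obtain m where "min (aL\<^sup>2) (aU\<^sup>2) = ereal m"
    by (cases "min (aL\<^sup>2) (aU\<^sup>2)") auto
  then show ?thesis
    unfolding logit_rate_limit_def by simp
qed

text \<open>Up to \<open>logit_rate_reflect\<close>, every admissible pair \<open>(aL, aU)\<close> satisfies the
  second hypothesis.\<close>

lemma logit_rate_tendsto_normalized:
  assumes "aL < aU" "aU \<le> 0 \<or> (aL < 0 \<and> aU \<noteq> \<infinity> \<and> aU\<^sup>2 \<le> aL\<^sup>2)"
  shows "(logit_rate c aL aU \<longlongrightarrow> logit_rate_limit aL aU) at_top"
proof -
  obtain r where r: "aU = ereal r"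
    using assms by (cases aU) auto
  consider "r < 0" | "r = 0" | "0 < r" "aL < 0" "ereal (r\<^sup>2) \<le> aL\<^sup>2"
    using assms r by (cases "r < 0"; cases "r = 0") auto
  then show ?thesis
  proof cases
    case 1
    then have "ereal (r\<^sup>2) < aL\<^sup>2"
      using assms(1) r by (intro ereal_power2_less_of_less_neg) simp_all
    then have "min (aL\<^sup>2) (aU\<^sup>2) = ereal (r\<^sup>2)"
      using r by (simp add: min_absorb2)
    then show ?thesis
      using logit_rate_tendsto_below[of aL r c] 1 assms r
      by (simp add: logit_rate_limit_def zero_ereal_def)
  next
    case 2
    have "min (aL\<^sup>2) 0 = 0"
      by (cases aL) (simp_all add: min_absorb2 power2_eq_square)
    then show ?thesis
      using logit_rate_tendsto_zero[of aL c] 2 assms r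
      by (simp add: logit_rate_limit_def zero_ereal_def)
  next
    case 3
    then have "min (aL\<^sup>2) (aU\<^sup>2) = ereal (r\<^sup>2)"
      using r by (simp add: min_def)
    then show ?thesis
      using logit_rate_tendsto_straddle[of aL r c] 3 r
      by (simp add: logit_rate_limit_def zero_ereal_def)
  qed
qed

lemma logit_rate_tendsto:
  assumes "aL < aU" "\<bar>aL\<bar> \<noteq> \<infinity> \<or> \<bar>aU\<bar> \<noteq> \<infinity>"
  shows "(logit_rate c aL aU \<longlongrightarrow> logit_rate_limit aL aU) at_top"
proof (cases "aU \<le> 0 \<or> (aL < 0 \<and> aU \<noteq> \<infinity> \<and> aU\<^sup>2 \<le> aL\<^sup>2)")
  case True
  with assms(1) show ?thesis
    by (rule logit_rate_tendsto_normalized)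
next
  case False
  with assms have "- aL \<le> 0 \<or> (- aU < 0 \<and> - aL \<noteq> \<infinity> \<and> (- aL)\<^sup>2 \<le> (- aU)\<^sup>2)"
    by (cases aL; cases aU) (auto simp: power2_eq_square)
  with assms(1) have "(logit_rate (- c) (- aU) (- aL) \<longlongrightarrow> logit_rate_limit (- aU) (- aL)) at_top"
    by (intro logit_rate_tendsto_normalized) simp_all
  then show ?thesis
    by (simp add: logit_rate_reflect logit_rate_limit_reflect)
qed

text \<open>Since \<open>(d - theta) / sqrt (inverse I) = (d - theta) * sqrt I\<close>, this extends \<open>a_std\<close>
  to \<open>delta = \<plusminus>\<infinity>\<close>, matching the conventions of \<open>p_post\<close> and \<open>a_sq\<close> when \<open>I > 0\<close>.\<close>

definition a_ext :: "real \<Rightarrow> real \<Rightarrow> ereal \<Rightarrow> ereal" where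
  "a_ext I theta delta = (delta - ereal theta) * ereal (sqrt I)"

lemma a_ext_simps:
  assumes "0 < I"
  shows "a_ext I theta (ereal d) = ereal (a_std I theta d)"
    "a_ext I theta \<infinity> = \<infinity>" "a_ext I theta (-\<infinity>) = -\<infinity>"
  using assms by (simp_all add: a_ext_def a_std_def real_sqrt_inverse divide_inverse)

lemma p_post_eq_Phi_path:
  "0 < I \<Longrightarrow> p_post I theta u delta n = Phi_path (Phi_inv u) (a_ext I theta delta) n"
  by (cases delta) (simp_all add: p_post_def a_ext_simps)

lemma a_sq_eq_a_ext_power2: "0 < I \<Longrightarrow> a_sq I theta delta = (a_ext I theta delta)\<^sup>2"
  by (cases delta) (simp_all add: a_sq_def a_ext_simps power2_eq_square)

lemma a_ext_strict_mono: "0 < I \<Longrightarrow> d < d' \<Longrightarrow> a_ext I theta d < a_ext I theta d'"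
  by (cases d; cases d') (simp_all add: a_ext_simps a_std_def divide_strict_right_mono)

lemma a_ext_less_0_iff: "0 < I \<Longrightarrow> a_ext I theta d < 0 \<longleftrightarrow> d < ereal theta"
  by (cases d) (simp_all add: a_ext_simps a_std_def divide_less_0_iff zero_ereal_def)

lemma a_ext_gt_0_iff: "0 < I \<Longrightarrow> 0 < a_ext I theta d \<longleftrightarrow> ereal theta < d"
  by (cases d) (simp_all add: a_ext_simps a_std_def zero_less_divide_iff zero_ereal_def)

lemma abs_a_ext_eq_infinity_iff: "0 < I \<Longrightarrow> \<bar>a_ext I theta d\<bar> = \<infinity> \<longleftrightarrow> \<bar>d\<bar> = \<infinity>"
  by (cases d) (simp_all add: a_ext_simps)

theorem theorem1:
  fixes deltaL deltaU :: ereal and theta I u :: real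
  assumes "deltaL < deltaU"
    and "\<bar>deltaL\<bar> \<noteq> \<infinity> \<or> \<bar>deltaU\<bar> \<noteq> \<infinity>"
    and "0 < I"
    and "0 < u" and "u < 1"
  defines "f \<equiv> (\<lambda>n. logit (p_post I theta u deltaU n - p_post I theta u deltaL n))"
  shows "(\<forall>\<^sub>F n in at_top. f differentiable (at n))
    \<and> ((\<lambda>n. ereal (deriv f n)) \<longlongrightarrow>
         ereal (0.5 - of_bool (ereal theta \<notin> {deltaL<..<deltaU}))
           * min (a_sq I theta deltaU) (a_sq I theta deltaL)) at_top"
proof -
  define aL aU where "aL = a_ext I theta deltaL" and "aU = a_ext I theta deltaU"
  have a: "aL < aU" "\<bar>aL\<bar> \<noteq> \<infinity> \<or> \<bar>aU\<bar> \<noteq> \<infinity>"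
    using assms(1-3) by (simp_all add: aL_def aU_def a_ext_strict_mono abs_a_ext_eq_infinity_iff)
  have "\<forall>\<^sub>F n in at_top. (f has_real_derivative logit_rate (Phi_inv u) aL aU n) (at n)"
    using eventually_gt_at_top[of 0] unfolding f_def aL_def aU_def
    by eventually_elim (use a assms(3) in \<open>simp add: p_post_eq_Phi_path aL_def aU_def
        has_real_derivative_logit_Phi_path_diff\<close>)
  then have deriv: "\<forall>\<^sub>F n in at_top. f differentiable (at n) \<and> logit_rate (Phi_inv u) aL aU n = deriv f n"
    by eventually_elim (auto simp: real_differentiable_def DERIV_imp_deriv)
  have lim: "(deriv f \<longlongrightarrow> logit_rate_limit aL aU) at_top"
    by (rule Lim_transform_eventually[OF logit_rate_tendsto[OF a]])
      (use deriv in \<open>auto elim: eventually_mono\<close>)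
  have "ereal theta \<in> {deltaL<..<deltaU} \<longleftrightarrow> aL < 0 \<and> 0 < aU"
    using assms(3) by (simp add: aL_def aU_def a_ext_less_0_iff a_ext_gt_0_iff)
  moreover have "a_sq I theta deltaL = aL\<^sup>2" "a_sq I theta deltaU = aU\<^sup>2"
    using assms(3) by (simp_all add: aL_def aU_def a_sq_eq_a_ext_power2)
  ultimately have "ereal (0.5 - of_bool (ereal theta \<notin> {deltaL<..<deltaU}))
      * min (a_sq I theta deltaU) (a_sq I theta deltaL) = ereal (logit_rate_limit aL aU)"
    by (simp add: ereal_logit_rate_limit[OF a(2)] min.commute)
  with lim deriv show ?thesis
    by (auto elim: eventually_mono)
qed

end
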